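(* If there exists a noncontributing provider, i.e. some $p\in Z$ with $M_\Omega^{Z}(1)-M_\Omega^{Z\setminus\{p\}}(1)=\widetilde\Omega_p(0)$, then the Shapley payoff for the game $(Z\cup H,v)$ (in the fluid limit) does not lie in the core.
   Context: Players: a finite set $Z$ of providers and a set $H$ of $\eta$ homogeneous peers. For $p\in Z$, $\Omega_p^\eta(x)$ is the (nonnegative) operational cost of provider $p$ when a fraction $x$ of the peers assists it; it is non-increasing in $x$. The worth of a coalition $S$ with exactly one provider $p$ is $\hat v(S)=\Omega_p^\eta(0)-\Omega_p^\eta(|S\cap H|/\eta)$, and $\hat v(S)=0$ if $S$ has no provider; the worth function is $v(S)=\hat v(S)$ if $S$ has at most one provider and otherwise $v(S)=\max\{\sum_{C\in\mathcal P}\hat v(C)\mid\mathcal P$ a partition of $S$ with exactly one provider in each $C\in\mathcal P\}$. Fluid limit $\eta\to\infty$: $\lim_{\eta\to\infty}\frac1\eta\Omega_p^\eta(\cdot)=\widetilde\Omega_p(\cdot)$, where $\widetilde\Omega_p\ge0$ is non-increasing and not constant on $[0,1]$ for every $p\in Z$. Define $M_\Omega^\emptyset(x):=0$ and $M_\Omega^S(x):=\min\{\sum_{i\in S}\widetilde\Omega_i(y_i)\mid\sum_{i\in S}y_i\le x,\ y_i\ge0\}$ for $S\subseteq Z$. The limit worth (divided by $\eta$) of the coalition of providers $T\subseteq Z$ and a fraction $y$ of the peers is $\sum_{i\in T}\widetilde\Omega_i(0)-M_\Omega^T(y)$. The fluid-limit Shapley payoffs in the grand coalition $Z\cup H$ (divided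 by $\eta$ for providers) are $$\widetilde\varphi_p^{Z}(1)=\widetilde\Omega_p(0)-\sum_{S\subseteq Z\setminus\{p\}}\int_0^1u^{|S|}(1-u)^{|Z|-1-|S|}\big(M_\Omega^{S\cup\{p\}}(u)-M_\Omega^S(u)\big)du\quad(p\in Z),$$ $$\widetilde\varphi_n^{Z}(1)=-\sum_{S\subseteq Z}\int_0^1u^{|S|}(1-u)^{|Z|-|S|}\frac{dM_\Omega^S}{dx}(u)\,du\quad(n\in H).$$ Core: a payoff vector $\phi$ of a game $(N,v)$ lies in the core if $\sum_{i\in N}\phi_i=v(N)$ and $\sum_{i\in K}\phi_i\ge v(K)$ for all $K\subseteq N$; here these conditions are read for the fluid-limit payoffs and limit worths.
   Formalization: Each limit cost $\widetilde\Omega_p$ is additionally assumed continuous on $[0,1]$; without it the claim fails, e.g. for $\widetilde\Omega_1=1$ on $[0,1)$, $\widetilde\Omega_1(1)=0$, $\widetilde\Omega_2(x)=10(1-x)$, where the Shapley payoff is in the core. *)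

theory Defs
  imports "HOL-Analysis.Analysis"
begin

text \<open>
  Throughout, \<open>\<Omega> p x\<close> is the fluid-limit operational cost of provider \<open>p\<close> when a fraction
  \<open>x \<in> [0,1]\<close> of the peers assists it; its values outside \<open>[0,1]\<close> have no effect on the payoffs and worths.
  Amounts of worth and provider payoffs are divided by the number of peers, peer payoffs are not.
\<close>

text \<open>
  The infimum is a minimum whenever the costs are continuous on \<open>[0,1]\<close> and \<open>0 \<le> x \<le> 1\<close>; see
  \<open>min_cost_attained\<close> below.
\<close>

definition min_cost :: "('p \<Rightarrow> real \<Rightarrow> real) \<Rightarrow> 'p set \<Rightarrow> real \<Rightarrow> real" where
  "min_cost \<Omega> S x =
     (if S = {} then 0
      else Inf {(\<Sum>i\<in>S. \<Omega> i (y i)) | y. (\<Sum>i\<in>S. y i) \<le> x \<and> (\<forall>i\<in>S. 0 \<le> y i)})"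

definition limit_worth :: "('p \<Rightarrow> real \<Rightarrow> real) \<Rightarrow> 'p set \<Rightarrow> real \<Rightarrow> real" where
  "limit_worth \<Omega> T y = (\<Sum>i\<in>T. \<Omega> i 0) - min_cost \<Omega> T y"

definition shapley_provider :: "('p \<Rightarrow> real \<Rightarrow> real) \<Rightarrow> 'p set \<Rightarrow> 'p \<Rightarrow> real" where
  "shapley_provider \<Omega> Z p =
     \<Omega> p 0 - (\<Sum>S\<in>Pow (Z - {p}).
       integral {0..1} (\<lambda>u. u ^ card S * (1 - u) ^ (card Z - 1 - card S) *
                            (min_cost \<Omega> (S \<union> {p}) u - min_cost \<Omega> S u)))"

text \<open>
  For non-increasing costs \<open>min_cost \<Omega> S\<close> is monotone on \<open>[0,1]\<close>, hence differentiable almost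
  everywhere there; the arbitrary value of \<open>deriv\<close> on the exceptional null set does not affect
  the integral.
\<close>

definition shapley_peer :: "('p \<Rightarrow> real \<Rightarrow> real) \<Rightarrow> 'p set \<Rightarrow> real" where
  "shapley_peer \<Omega> Z =
     - (\<Sum>S\<in>Pow Z.
         integral {0..1} (\<lambda>u. u ^ card S * (1 - u) ^ (card Z - card S) *
                              deriv (min_cost \<Omega> S) u))"

text \<open>
  A payoff vector is a pair \<open>(\<phi>, \<psi>)\<close>: \<open>\<phi> p\<close> is the payoff of provider \<open>p\<close>, and \<open>\<psi>\<close> is the common
  payoff of the homogeneous peers, so that a fraction \<open>y\<close> of the peers jointly receives \<open>y * \<psi>\<close>.
  Coalitions consist of a set \<open>T \<subseteq> Z\<close> of providers and a fraction \<open>y\<close> of the peers.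
\<close>

definition fluid_core :: "('p \<Rightarrow> real \<Rightarrow> real) \<Rightarrow> 'p set \<Rightarrow> (('p \<Rightarrow> real) \<times> real) set" where
  "fluid_core \<Omega> Z =
     {(\<phi>, \<psi>). (\<Sum>p\<in>Z. \<phi> p) + \<psi> = limit_worth \<Omega> Z 1 \<and>
       (\<forall>T y. T \<subseteq> Z \<longrightarrow> 0 \<le> y \<longrightarrow> y \<le> 1 \<longrightarrow> limit_worth \<Omega> T y \<le> (\<Sum>p\<in>T. \<phi> p) + y * \<psi>)}"

definition noncontributing :: "('p \<Rightarrow> real \<Rightarrow> real) \<Rightarrow> 'p set \<Rightarrow> 'p \<Rightarrow> bool" where
  "noncontributing \<Omega> Z p \<longleftrightarrow>
     p \<in> Z \<and> min_cost \<Omega> Z 1 - min_cost \<Omega> (Z - {p}) 1 = \<Omega> p 0"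

lemma min_cost_attained:
  fixes \<Omega> :: "'p \<Rightarrow> real \<Rightarrow> real"
  assumes fin: "finite S" and x: "0 \<le> x" "x \<le> 1"
    and cont: "\<And>i. i \<in> S \<Longrightarrow> continuous_on {0..1} (\<Omega> i)"
  shows "\<exists>y. (\<Sum>i\<in>S. y i) \<le> x \<and> (\<forall>i\<in>S. 0 \<le> y i) \<and>
             min_cost \<Omega> S x = (\<Sum>i\<in>S. \<Omega> i (y i)) \<and>
             (\<forall>z. (\<Sum>i\<in>S. z i) \<le> x \<and> (\<forall>i\<in>S. 0 \<le> z i) \<longrightarrow>
                  min_cost \<Omega> S x \<le> (\<Sum>i\<in>S. \<Omega> i (z i)))"
proof -
  define K where "K = (\<lambda>i. if i \<in> S then {0..x} else {0::real})"
  define B where "B = {y. (\<Sum>i\<in>S. y i) \<le> x} \<inter> PiE UNIV K"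
  have "compactin (product_topology (\<lambda>_. euclidean) UNIV) (PiE UNIV K)"
    by (subst compactin_PiE) (auto simp: K_def)
  then have "compact (PiE UNIV K)"
    by (metis compactin_euclidean_iff euclidean_product_topology)
  moreover have "continuous_on UNIV (\<lambda>y::'p \<Rightarrow> real. \<Sum>i\<in>S. y i)"
    by (intro continuous_intros continuous_on_product_coordinates)
  then have "closed {y::'p \<Rightarrow> real. (\<Sum>i\<in>S. y i) \<le> x}"
    by (intro closed_Collect_le continuous_on_const)
  ultimately have B: "compact B"
    unfolding B_def by (simp add: closed_Int_compact)
  have "(\<lambda>_. 0) \<in> B" using x by (auto simp: B_def K_def)
  then have ne: "B \<noteq> {}" by blast
  have cont_coord: "continuous_on B (\<lambda>y. \<Omega> i (y i))" if "i \<in> S" for i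
  proof (rule continuous_on_compose2[OF cont[OF that]])
    show "continuous_on B (\<lambda>y. y i)"
      by (rule continuous_on_subset[OF continuous_on_product_coordinates]) auto
    have "y i \<in> {0..1}" if "y \<in> B" for y
    proof -
      have "y i \<in> K i" using that by (auto simp: B_def)
      then show ?thesis using x \<open>i \<in> S\<close> by (auto simp: K_def)
    qed
    then show "(\<lambda>y. y i) ` B \<subseteq> {0..1}" by auto
  qed
  have "continuous_on B (\<lambda>y. \<Sum>i\<in>S. \<Omega> i (y i))"
    by (intro continuous_on_sum cont_coord)
  from continuous_attains_inf[OF B ne this] obtain y where y: "y \<in> B"
    and le: "\<And>z. z \<in> B \<Longrightarrow> (\<Sum>i\<in>S. \<Omega> i (y i)) \<le> (\<Sum>i\<in>S. \<Omega> i (z i))" by blast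
  have y0: "0 \<le> y i" if "i \<in> S" for i
  proof -
    have "y i \<in> K i" using y by (auto simp: B_def)
    then show ?thesis using that by (auto simp: K_def)
  qed
  have ysum: "(\<Sum>i\<in>S. y i) \<le> x" using y by (simp add: B_def)
  have least: "(\<Sum>i\<in>S. \<Omega> i (y i)) \<le> (\<Sum>i\<in>S. \<Omega> i (z i))"
    if z: "(\<Sum>i\<in>S. z i) \<le> x" "\<forall>i\<in>S. 0 \<le> z i" for z
  proof -
    define w where "w i = (if i \<in> S then z i else 0)" for i
    have "z i \<le> x" if "i \<in> S" for i
      using member_le_sum[of i S z] fin z that by auto
    then have "w \<in> B" using z by (auto simp: B_def K_def w_def PiE_def extensional_def)
    then show ?thesis using le[of w] by (simp add: w_def)
  qed
  have "min_cost \<Omega> S x = (\<Sum>i\<in>S. \<Omega> i (y i))"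
  proof (cases "S = {}")
    case False
    then show ?thesis unfolding min_cost_def
      using y0 ysum least by (auto intro!: cInf_eq_minimum)
  qed (simp add: min_cost_def)
  with y0 ysum least show ?thesis by (intro exI[of _ y]) auto
qed

end

theory Submission
  imports Defs
begin

text \<open>
  Marginal contributions are nonnegative, so every term of the Shapley payoff of a provider is
  nonnegative, and the term in which the provider is matched with peers alone is positive because
  its cost is not constant.  On the other hand, the coalition without a noncontributing provider
  generates the whole worth, so in the core this provider receives at most \<open>0\<close>.
\<close>

lemma min_cost_le:
  fixes \<Omega> :: "'p \<Rightarrow> real \<Rightarrow> real"
  assumes "finite S" "0 \<le> x" "x \<le> 1"
    and "\<And>i. i \<in> S \<Longrightarrow> continuous_on {0..1} (\<Omega> i)"
    and "(\<Sum>i\<in>S. z i) \<le> x" "\<And>i. i \<in> S \<Longrightarrow> 0 \<le> z i"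
  shows "min_cost \<Omega> S x \<le> (\<Sum>i\<in>S. \<Omega> i (z i))"
  using min_cost_attained[of S x \<Omega>] assms by blast

text \<open>An optimal allocation for the smaller budget stays feasible for the larger one. This
  monotonicity later yields integrability of the Shapley integrands.\<close>

lemma antimono_on_min_cost:
  fixes \<Omega> :: "'p \<Rightarrow> real \<Rightarrow> real"
  assumes "finite S" "\<And>i. i \<in> S \<Longrightarrow> continuous_on {0..1} (\<Omega> i)"
  shows "antimono_on {0..1} (min_cost \<Omega> S)"
proof (rule monotone_onI)
  fix x x' :: real
  assume x: "x \<in> {0..1}" "x' \<in> {0..1}" "x \<le> x'"
  obtain y where "(\<Sum>i\<in>S. y i) \<le> x" "\<forall>i\<in>S. 0 \<le> y i"
    and "min_cost \<Omega> S x = (\<Sum>i\<in>S. \<Omega> i (y i))"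
    using min_cost_attained[of S x \<Omega>] assms x(1) by auto
  then show "min_cost \<Omega> S x' \<le> min_cost \<Omega> S x"
    using min_cost_le[of S x' \<Omega> y] assms x by auto
qed

text \<open>A non-increasing cost is lowest when the only provider takes the whole budget, so the
  inequality constraint may be taken as tight.\<close>

lemma min_cost_singleton:
  fixes \<Omega> :: "'p \<Rightarrow> real \<Rightarrow> real"
  assumes "x \<in> {0..1}" "continuous_on {0..1} (\<Omega> p)" "antimono_on {0..1} (\<Omega> p)"
  shows "min_cost \<Omega> {p} x = \<Omega> p x"
proof (rule antisym)
  show "min_cost \<Omega> {p} x \<le> \<Omega> p x"
    using min_cost_le[of "{p}" x \<Omega> "\<lambda>_. x"] assms by simp
  obtain y where "y p \<le> x" "0 \<le> y p" "min_cost \<Omega> {p} x = \<Omega> p (y p)"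
    using min_cost_attained[of "{p}" x \<Omega>] assms by auto
  then show "\<Omega> p x \<le> min_cost \<Omega> {p} x"
    using monotone_onD[OF assms(3), of "y p" x] assms(1) by simp
qed

text \<open>This makes the marginal worth of \<open>p\<close> nonnegative: keep an optimal
  allocation for \<open>S\<close> and assign no peers to \<open>p\<close>, whose cost is then
  \<open>\<Omega> p 0\<close>.\<close>

lemma min_cost_insert_le:
  fixes \<Omega> :: "'p \<Rightarrow> real \<Rightarrow> real"
  assumes "finite S" "p \<notin> S" "x \<in> {0..1}"
    and cont: "\<And>i. i \<in> insert p S \<Longrightarrow> continuous_on {0..1} (\<Omega> i)"
  shows "min_cost \<Omega> (insert p S) x \<le> \<Omega> p 0 + min_cost \<Omega> S x"
proof -
  obtain y where y: "(\<Sum>i\<in>S. y i) \<le> x" "\<forall>i\<in>S. 0 \<le> y i"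
    "min_cost \<Omega> S x = (\<Sum>i\<in>S. \<Omega> i (y i))"
    using min_cost_attained[of S x \<Omega>] assms by auto
  have upd: "(\<Sum>i\<in>S. (y(p := 0)) i) = (\<Sum>i\<in>S. y i)"
    "(\<Sum>i\<in>S. \<Omega> i ((y(p := 0)) i)) = (\<Sum>i\<in>S. \<Omega> i (y i))"
    using \<open>p \<notin> S\<close> by (auto intro!: sum.cong)
  have "min_cost \<Omega> (insert p S) x \<le> (\<Sum>i\<in>insert p S. \<Omega> i ((y(p := 0)) i))"
  proof (rule min_cost_le)
    show "(\<Sum>i\<in>insert p S. (y(p := 0)) i) \<le> x"
      using assms(1,2) y(1) upd(1) by (simp del: fun_upd_apply) simp
    show "0 \<le> (y(p := 0)) i" if "i \<in> insert p S" for i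
      using that y(2) by auto
  qed (use assms in auto)
  also have "\<dots> = \<Omega> p 0 + min_cost \<Omega> S x"
    using assms(1,2) y(3) upd(2) by (simp del: fun_upd_apply) simp
  finally show ?thesis .
qed

text \<open>For \<open>u\<close> in [0,1] the summand is the probability that a random subset,
  containing each element independently with probability \<open>u\<close>, equals \<open>S\<close>.
  Algebraically, the sum is the expansion of a product of factors
  \<open>u + (1 - u)\<close>.\<close>

lemma sum_Pow_binomial_weights:
  fixes u :: "'a::comm_ring_1"
  assumes "finite A"
  shows "(\<Sum>S\<in>Pow A. u ^ card S * (1 - u) ^ (card A - card S)) = 1"
proof -
  have "(\<Sum>S\<in>Pow A. u ^ card S * (1 - u) ^ (card A - card S)) =
        (\<Sum>S\<in>Pow A. (\<Prod>i\<in>S. u) * (\<Prod>i\<in>A - S. 1 - u))"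
    using assms by (intro sum.cong) (auto simp: card_Diff_subset finite_subset)
  also have "\<dots> = (\<Prod>i\<in>A. u + (1 - u))"
    by (rule prod_add[OF assms, symmetric])
  finally show ?thesis by simp
qed

text \<open>Since the weights sum to 1, the leading \<open>\<Omega> p 0\<close> can be distributed
  over the coalitions. The payoff becomes a sum of integrals of weighted marginal worths, whose
  signs can be examined one by one.\<close>

lemma shapley_provider_alt:
  fixes \<Omega> :: "'p \<Rightarrow> real \<Rightarrow> real"
  assumes "finite Z" "p \<in> Z"
    and cont: "\<And>i. i \<in> Z \<Longrightarrow> continuous_on {0..1} (\<Omega> i)"
  defines "g \<equiv> \<lambda>S u. u ^ card S * (1 - u) ^ (card Z - 1 - card S) *
                  (\<Omega> p 0 - (min_cost \<Omega> (insert p S) u - min_cost \<Omega> S u))"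
  shows "shapley_provider \<Omega> Z p = (\<Sum>S\<in>Pow (Z - {p}). integral {0..1} (g S))"
    and "\<And>S. S \<subseteq> Z - {p} \<Longrightarrow> g S integrable_on {0..1}"
proof -
  define w where "w S u = u ^ card S * (1 - u) ^ (card Z - 1 - card S)" for S :: "'p set" and u :: real
  define d where "d S u = min_cost \<Omega> (insert p S) u - min_cost \<Omega> S u" for S u
  have w: "(\<lambda>u. w S u * c) integrable_on {0..1}" for S and c :: real
    unfolding w_def by (intro integrable_continuous_real continuous_intros)
  \<comment> \<open>Only monotonicity of \<open>min_cost \<Omega> T\<close> is available here. The
    second mean value theorem supplies the integral of a monotone function times an integrable one;
    it asks for a non-decreasing function, hence the negation.\<close>
  have wM: "(\<lambda>u. w S u * min_cost \<Omega> T u) integrable_on {0..1}" if "T \<subseteq> Z" for S T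
  proof -
    have "antimono_on {0..1} (min_cost \<Omega> T)"
      using that cont assms(1) by (intro antimono_on_min_cost) (auto intro: finite_subset)
    then have "- min_cost \<Omega> T u \<le> - min_cost \<Omega> T v" if "0 \<le> u" "u \<le> v" "v \<le> 1" for u v
      using that by (auto simp: monotone_on_def)
    moreover have "w S integrable_on {0..1}"
      using w[of S 1] by simp
    ultimately obtain c where "((\<lambda>u. - min_cost \<Omega> T u * w S u) has_integral
        (- min_cost \<Omega> T 0 * integral {0..c} (w S) + - min_cost \<Omega> T 1 * integral {c..1} (w S))) {0..1}"
      using second_mean_value_theorem_full[of "w S" 0 1 "\<lambda>u. - min_cost \<Omega> T u"]
      by (metis zero_le_one)
    from has_integral_neg[OF this] show ?thesis
      by (auto simp: mult.commute integrable_on_def)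
  qed
  have wd: "(\<lambda>u. w S u * d S u) integrable_on {0..1}" if "S \<subseteq> Z - {p}" for S
    unfolding d_def right_diff_distrib using that \<open>p \<in> Z\<close>
    by (intro integrable_diff wM) auto
  have g: "g S = (\<lambda>u. w S u * \<Omega> p 0 - w S u * d S u)" for S
    by (simp add: g_def w_def d_def fun_eq_iff algebra_simps)
  show "g S integrable_on {0..1}" if "S \<subseteq> Z - {p}" for S
    unfolding g using that by (intro integrable_diff w wd)
  have "(\<Sum>S\<in>Pow (Z - {p}). integral {0..1} (\<lambda>u. w S u * \<Omega> p 0)) =
        integral {0..1} (\<lambda>u. \<Sum>S\<in>Pow (Z - {p}). w S u * \<Omega> p 0)"
    using assms(1) w by (intro integral_sum[symmetric]) auto
  \<comment> \<open>The exponent matches the binomial weights on \<open>Z - {p}\<close>, whose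
    cardinality is \<open>card Z - 1\<close>.\<close>
  also have "\<dots> = \<Omega> p 0"
    using sum_Pow_binomial_weights[of "Z - {p}", where 'a = real] assms(1,2)
    by (simp add: w_def flip: sum_distrib_right)
  finally have "\<Omega> p 0 = (\<Sum>S\<in>Pow (Z - {p}). integral {0..1} (\<lambda>u. w S u * \<Omega> p 0))" ..
  then have "shapley_provider \<Omega> Z p = (\<Sum>S\<in>Pow (Z - {p}).
      integral {0..1} (\<lambda>u. w S u * \<Omega> p 0) - integral {0..1} (\<lambda>u. w S u * d S u))"
    by (simp add: shapley_provider_def w_def d_def sum_subtractf)
  also have "\<dots> = (\<Sum>S\<in>Pow (Z - {p}). integral {0..1} (g S))"
    unfolding g by (intro sum.cong integral_diff[symmetric] w wd) auto
  finally show "shapley_provider \<Omega> Z p = (\<Sum>S\<in>Pow (Z - {p}). integral {0..1} (g S))" .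
qed

lemma shapley_provider_pos:
  fixes \<Omega> :: "'p \<Rightarrow> real \<Rightarrow> real"
  assumes "finite Z" "p \<in> Z"
    and cont: "\<And>i. i \<in> Z \<Longrightarrow> continuous_on {0..1} (\<Omega> i)"
    and anti: "antimono_on {0..1} (\<Omega> p)"
    and nonconst: "\<not> \<Omega> p constant_on {0..1}"
  shows "0 < shapley_provider \<Omega> Z p"
proof -
  define g where "g S u = u ^ card S * (1 - u) ^ (card Z - 1 - card S) *
      (\<Omega> p 0 - (min_cost \<Omega> (insert p S) u - min_cost \<Omega> S u))" for S u
  note alt = shapley_provider_alt[of Z p \<Omega>, OF assms(1,2) cont, folded g_def]
  have g0: "0 \<le> g S u" if "S \<subseteq> Z - {p}" "u \<in> {0..1}" for S u
  proof -
    have "min_cost \<Omega> (insert p S) u \<le> \<Omega> p 0 + min_cost \<Omega> S u"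
      using that assms(1,2) cont by (intro min_cost_insert_le) (auto intro: finite_subset)
    then show ?thesis using that(2) by (simp add: g_def)
  qed
  \<comment> \<open>On [0,1] this is the term of the empty coalition with both minimal costs
    evaluated, a form in which continuity is evident.\<close>
  define h where "h u = (1 - u) ^ (card Z - 1) * (\<Omega> p 0 - \<Omega> p u)" for u
  have h: "g {} u = h u" if "u \<in> {0..1}" for u
    using min_cost_singleton[of u \<Omega> p] that assms(2) cont anti
    by (simp add: g_def h_def min_cost_def[of _ "{}"])
  \<comment> \<open>A continuous nonnegative function with zero integral vanishes identically, which
    would make the cost of \<open>p\<close> constant.\<close>
  have "integral {0..1} h \<noteq> 0"
  proof
    assume "integral {0..1} h = 0"
    moreover have "continuous_on {0..1} h"
      unfolding h_def using cont[OF assms(2)] by (intro continuous_intros)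
    moreover have "0 \<le> h u" if "u \<in> {0..1}" for u
      using g0[of "{}" u] h[OF that] that by simp
    ultimately have zero: "\<forall>u\<in>{0..1}. h u = 0"
      using integral_eq_0_iff[of 0 1 h] by simp
    \<comment> \<open>The weight can be cancelled only for \<open>u < 1\<close>, because at 1 it
      vanishes as soon as there is a second provider. Continuity of \<open>\<Omega> p\<close> then
      covers the endpoint.\<close>
    have eq: "\<Omega> p u = \<Omega> p 0" if "u \<in> {0..<1}" for u
      using zero[rule_format, of u] that by (simp add: h_def)
    have "\<Omega> p u = \<Omega> p 0" if "u \<in> {0..1}" for u
      using that cont[OF assms(2)]
      by (intro continuous_constant_on_closure[of "{0..<1}", OF _ eq]) simp_all
    then show False using nonconst unfolding constant_on_def by blast
  qed
  moreover have "integral {0..1} (g {}) = integral {0..1} h"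
    by (rule integral_cong) (rule h)
  moreover have nonneg: "0 \<le> integral {0..1} (g S)" if "S \<subseteq> Z - {p}" for S
    using that by (intro integral_nonneg alt(2) g0)
  ultimately have "0 < integral {0..1} (g {})"
    using nonneg[of "{}"] by simp
  also have "\<dots> \<le> (\<Sum>S\<in>Pow (Z - {p}). integral {0..1} (g S))"
    using assms(1) nonneg by (intro member_le_sum) auto
  finally show ?thesis by (simp add: alt(1))
qed

lemma fluid_core_noncontributing_le_0:
  assumes "finite Z" "(\<phi>, \<psi>) \<in> fluid_core \<Omega> Z" "noncontributing \<Omega> Z p"
  shows "\<phi> p \<le> 0"
proof -
  have p: "p \<in> Z" and eq: "min_cost \<Omega> Z 1 - min_cost \<Omega> (Z - {p}) 1 = \<Omega> p 0"
    using assms(3) by (auto simp: noncontributing_def)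
  \<comment> \<open>Dropping \<open>p\<close> lowers the total unassisted cost and the minimal cost
    by the same amount \<open>\<Omega> p 0\<close>.\<close>
  have "limit_worth \<Omega> (Z - {p}) 1 = limit_worth \<Omega> Z 1"
    using eq sum.remove[OF assms(1) p, of "\<lambda>i. \<Omega> i 0"] by (simp add: limit_worth_def)
  \<comment> \<open>The core inequality for all peers together with all providers but
    \<open>p\<close>; subtracting it from the efficiency equation isolates
    \<open>\<phi> p\<close>.\<close>
  moreover have "limit_worth \<Omega> (Z - {p}) 1 \<le> (\<Sum>i\<in>Z - {p}. \<phi> i) + 1 * \<psi>"
    using assms(2) unfolding fluid_core_def mem_Collect_eq prod.case
    by (meson Diff_subset order_refl zero_le_one)
  moreover have "(\<Sum>i\<in>Z. \<phi> i) + \<psi> = limit_worth \<Omega> Z 1"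
    using assms(2) by (simp add: fluid_core_def)
  ultimately show ?thesis
    using sum.remove[OF assms(1) p, of \<phi>] by simp
qed

theorem theorem2:
  fixes Z :: "'p set"
    and cost :: "nat \<Rightarrow> 'p \<Rightarrow> real \<Rightarrow> real"
    and \<Omega> :: "'p \<Rightarrow> real \<Rightarrow> real"
  assumes "finite Z"
    and "\<And>\<eta> p x. \<eta> \<ge> 1 \<Longrightarrow> p \<in> Z \<Longrightarrow> x \<in> {0..1} \<Longrightarrow> cost \<eta> p x \<ge> 0"
    and "\<And>\<eta> p. \<eta> \<ge> 1 \<Longrightarrow> p \<in> Z \<Longrightarrow> antimono_on {0..1} (cost \<eta> p)"
    and "\<And>p x. p \<in> Z \<Longrightarrow> x \<in> {0..1} \<Longrightarrow> (\<lambda>\<eta>. cost \<eta> p x / real \<eta>) \<longlonglongrightarrow> \<Omega> p x"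
    and "\<And>p x. p \<in> Z \<Longrightarrow> x \<in> {0..1} \<Longrightarrow> \<Omega> p x \<ge> 0"
    and "\<And>p. p \<in> Z \<Longrightarrow> antimono_on {0..1} (\<Omega> p)"
    and "\<And>p. p \<in> Z \<Longrightarrow> \<not> \<Omega> p constant_on {0..1}"
    and "\<And>p. p \<in> Z \<Longrightarrow> continuous_on {0..1} (\<Omega> p)"
    and "\<exists>p. noncontributing \<Omega> Z p"
  shows "(shapley_provider \<Omega> Z, shapley_peer \<Omega> Z) \<notin> fluid_core \<Omega> Z"
proof
  assume core: "(shapley_provider \<Omega> Z, shapley_peer \<Omega> Z) \<in> fluid_core \<Omega> Z"
  obtain p where p: "noncontributing \<Omega> Z p" using assms(9) by blast
  then have "p \<in> Z" by (simp add: noncontributing_def)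
  \<comment> \<open>Positivity holds for every provider in \<open>Z\<close>; at a noncontributing
    one it collides with the upper bound 0 imposed by the core.\<close>
  then have "0 < shapley_provider \<Omega> Z p"
    using assms(1,6,7,8) by (intro shapley_provider_pos)
  then show False
    using fluid_core_noncontributing_le_0[OF assms(1) core p] by simp
qed

end
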